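(* Let $n\ge 2$ be an integer and let $D_n$ be the dihedral group of order $2n$. The co-maximal hypergraph $Co_{\mathcal{H}}(D_n)$ is a $3$-uniform hypergraph if and only if $n=2^{\alpha}$, where $\alpha$ is a positive integer.
   Context: For $n\ge 1$, $D_n=\langle a,b \mid a^n=e,\ b^2=e,\ bab^{-1}=a^{-1}\rangle$ is the dihedral group of order $2n$ (so $D_2$ is the Klein four-group). For a group $G$, let $S$ be the set of all non-trivial proper subgroups of $G$ (i.e. subgroups different from $\{e\}$ and $G$). For subgroups $H,K$, $HK=\{hk : h\in H, k\in K\}$. The co-maximal hypergraph $Co_{\mathcal{H}}(G)$ has vertex set $V=\{H\in S : HK=G \text{ for some } K\in S\}$, and a subset $E\subseteq V$ is a hyperedge if and only if (1) $HK=G$ for all distinct $H,K\in E$, and (2) no subset $E'\subseteq V$ properly containing $E$ satisfies (1). A hypergraph is $r$-uniform ($r\ge 2$) if every hyperedge has exactly $r$ elements. *)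

theory Defs
  imports "HOL-Algebra.Coset"
begin

subsection \<open>Group presentations\<close>

text \<open>The letter \<open>(g, True)\<close> stands for the generator \<open>g\<close> and \<open>(g, False)\<close> for its
  formal inverse. The set \<open>R\<close> consists of relators, i.e. words declared to be trivial.\<close>

type_synonym 'g word = "('g \<times> bool) list"

inductive pres_eq :: "'g word set \<Rightarrow> 'g word \<Rightarrow> 'g word \<Rightarrow> bool" for R where
  refl: "pres_eq R u u"
| sym: "pres_eq R u v \<Longrightarrow> pres_eq R v u"
| trans: "pres_eq R u v \<Longrightarrow> pres_eq R v w \<Longrightarrow> pres_eq R u w"
| cancel: "pres_eq R (u @ [(g, s), (g, \<not> s)] @ v) (u @ v)"
| relator: "r \<in> R \<Longrightarrow> pres_eq R (u @ r @ v) (u @ v)"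

definition word_class :: "'g word set \<Rightarrow> 'g word \<Rightarrow> 'g word set" where
  "word_class R u = {v. pres_eq R u v}"

definition presented_group :: "'g word set \<Rightarrow> 'g word set monoid" where
  "presented_group R =
     \<lparr>carrier = range (word_class R),
      monoid.mult = (\<lambda>X Y. \<Union>x\<in>X. \<Union>y\<in>Y. word_class R (x @ y)),
      one = word_class R []\<rparr>"

subsection \<open>Dihedral groups\<close>

datatype dih_gen = Gen_a | Gen_b

text \<open>The relation \<open>b a b\<inverse> = a\<inverse>\<close> is expressed by the relator \<open>b a b\<inverse> a\<close>.\<close>

definition dihedral_relators :: "nat \<Rightarrow> dih_gen word set" where
  "dihedral_relators n =
     {replicate n (Gen_a, True),
      [(Gen_b, True), (Gen_b, True)],
      [(Gen_b, True), (Gen_a, True), (Gen_b, False), (Gen_a, True)]}"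

definition dihedral_group :: "nat \<Rightarrow> dih_gen word set monoid" where
  "dihedral_group n = presented_group (dihedral_relators n)"

definition dih_a :: "nat \<Rightarrow> dih_gen word set" where
  "dih_a n = word_class (dihedral_relators n) [(Gen_a, True)]"

definition dih_b :: "nat \<Rightarrow> dih_gen word set" where
  "dih_b n = word_class (dihedral_relators n) [(Gen_b, True)]"

subsection \<open>The co-maximal hypergraph of a group\<close>

text \<open>A hypergraph is a pair consisting of its vertex set and its set of hyperedges.\<close>

type_synonym 'v hypergraph = "'v set \<times> 'v set set"

definition uniform_hypergraph :: "nat \<Rightarrow> 'v hypergraph \<Rightarrow> bool" where
  "uniform_hypergraph r H \<longleftrightarrow> 2 \<le> r \<and> (\<forall>E \<in> snd H. card E = r)"

definition nontrivial_proper_subgroups :: "('a, 'b) monoid_scheme \<Rightarrow> 'a set set" where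
  "nontrivial_proper_subgroups G = {H. subgroup H G \<and> H \<noteq> {\<one>\<^bsub>G\<^esub>} \<and> H \<noteq> carrier G}"

definition comaximal_vertices :: "('a, 'b) monoid_scheme \<Rightarrow> 'a set set" where
  "comaximal_vertices G =
     {H \<in> nontrivial_proper_subgroups G.
        \<exists>K \<in> nontrivial_proper_subgroups G. H <#>\<^bsub>G\<^esub> K = carrier G}"

definition pairwise_comaximal :: "('a, 'b) monoid_scheme \<Rightarrow> 'a set set \<Rightarrow> bool" where
  "pairwise_comaximal G E \<longleftrightarrow> (\<forall>H\<in>E. \<forall>K\<in>E. H \<noteq> K \<longrightarrow> H <#>\<^bsub>G\<^esub> K = carrier G)"

definition comaximal_hyperedges :: "('a, 'b) monoid_scheme \<Rightarrow> 'a set set set" where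
  "comaximal_hyperedges G =
     {E. E \<subseteq> comaximal_vertices G \<and> pairwise_comaximal G E \<and>
         \<not> (\<exists>E'. E' \<subseteq> comaximal_vertices G \<and> E \<subset> E' \<and> pairwise_comaximal G E')}"

definition comaximal_hypergraph :: "('a, 'b) monoid_scheme \<Rightarrow> 'a set hypergraph" where
  "comaximal_hypergraph G = (comaximal_vertices G, comaximal_hyperedges G)"

subsection \<open>Basic facts about presented groups and dihedral groups\<close>

lemma pres_eq_ctx: "pres_eq R u v \<Longrightarrow> pres_eq R (x @ u @ y) (x @ v @ y)"
proof (induction rule: pres_eq.induct)
  case (cancel u g s v)
  show ?case using pres_eq.cancel[of R "x @ u" g s "v @ y"] by simp
next
  case (relator r u v)
  then show ?case using pres_eq.relator[of r R "x @ u" "v @ y"] by simp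
qed (auto intro: pres_eq.refl pres_eq.sym pres_eq.trans)

lemma pres_eq_append:
  assumes "pres_eq R u v" "pres_eq R x y"
  shows "pres_eq R (u @ x) (v @ y)"
  using pres_eq_ctx[OF assms(1), of "[]" x] pres_eq_ctx[OF assms(2), of v "[]"]
  by (auto intro: pres_eq.trans)

lemma word_class_eq_iff: "word_class R u = word_class R v \<longleftrightarrow> pres_eq R u v"
  unfolding word_class_def
  by (auto intro: pres_eq.refl pres_eq.sym pres_eq.trans)

lemma mult_word_class:
  "word_class R u \<otimes>\<^bsub>presented_group R\<^esub> word_class R v = word_class R (u @ v)"
proof -
  have "word_class R (x @ y) = word_class R (u @ v)"
    if "x \<in> word_class R u" "y \<in> word_class R v" for x y
  proof -
    have "pres_eq R u x" "pres_eq R v y" using that by (simp_all add: word_class_def)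
    then show ?thesis
      unfolding word_class_eq_iff by (intro pres_eq.sym[OF pres_eq_append])
  qed
  moreover have "u \<in> word_class R u" "v \<in> word_class R v"
    by (simp_all add: word_class_def pres_eq.refl)
  ultimately have "(\<Union>x\<in>word_class R u. \<Union>y\<in>word_class R v. word_class R (x @ y)) =
      word_class R (u @ v)"
    by blast
  then show ?thesis by (simp add: presented_group_def)
qed

lemma one_presented_group: "\<one>\<^bsub>presented_group R\<^esub> = word_class R []"
  by (simp add: presented_group_def)

lemma carrier_presented_group: "carrier (presented_group R) = range (word_class R)"
  by (simp add: presented_group_def)

lemma pres_eq_inverse: "pres_eq R (map (map_prod id Not) (rev w) @ w) []"
proof (induction w)
  case Nil
  show ?case by (simp add: pres_eq.refl)
next
  case (Cons l w)
  obtain g s where l: "l = (g, s)" by fastforce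
  have "pres_eq R (map (map_prod id Not) (rev (l # w)) @ l # w) (map (map_prod id Not) (rev w) @ w)"
    using pres_eq.cancel[of R "map (map_prod id Not) (rev w)" g "\<not> s" w] by (simp add: l)
  then show ?case using Cons by (rule pres_eq.trans)
qed

lemma group_presented_group: "group (presented_group R)"
proof (rule groupI)
  fix x assume "x \<in> carrier (presented_group R)"
  then obtain w where w: "x = word_class R w" by (auto simp: carrier_presented_group)
  show "\<exists>y\<in>carrier (presented_group R). y \<otimes>\<^bsub>presented_group R\<^esub> x = \<one>\<^bsub>presented_group R\<^esub>"
    by (rule bexI[of _ "word_class R (map (map_prod id Not) (rev w))"])
       (auto simp: w mult_word_class one_presented_group carrier_presented_group
          word_class_eq_iff pres_eq_inverse)
qed (auto simp: carrier_presented_group mult_word_class one_presented_group)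

lemma inv_word_class:
  "inv\<^bsub>presented_group R\<^esub> (word_class R w) = word_class R (map (map_prod id Not) (rev w))"
  by (rule group.inv_equality[OF group_presented_group])
     (auto simp: mult_word_class one_presented_group carrier_presented_group
        word_class_eq_iff pres_eq_inverse)

lemma pow_word_class:
  "word_class R [l] [^]\<^bsub>presented_group R\<^esub> (k::nat) = word_class R (replicate k l)"
proof (induction k)
  case 0
  show ?case by (simp add: nat_pow_def one_presented_group)
next
  case (Suc k)
  then show ?case
    by (simp add: monoid.nat_pow_Suc[OF group.is_monoid[OF group_presented_group]]
        mult_word_class flip: replicate_append_same)
qed

lemma group_dihedral_group: "group (dihedral_group n)"
  by (simp add: dihedral_group_def group_presented_group)

lemma dih_gens_in_carrier:
  "dih_a n \<in> carrier (dihedral_group n)" "dih_b n \<in> carrier (dihedral_group n)"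
  by (auto simp: dih_a_def dih_b_def dihedral_group_def carrier_presented_group)

lemma dihedral_relations:
  fixes n :: nat
  defines "G \<equiv> dihedral_group n"
  shows "dih_a n [^]\<^bsub>G\<^esub> n = \<one>\<^bsub>G\<^esub>"
    and "dih_b n [^]\<^bsub>G\<^esub> (2::nat) = \<one>\<^bsub>G\<^esub>"
    and "dih_b n \<otimes>\<^bsub>G\<^esub> dih_a n \<otimes>\<^bsub>G\<^esub> inv\<^bsub>G\<^esub> (dih_b n) = inv\<^bsub>G\<^esub> (dih_a n)"
proof -
  let ?R = "dihedral_relators n"
  have rel: "pres_eq ?R r []" if "r \<in> ?R" for r
    using pres_eq.relator[OF that, of "[]" "[]"] by simp
  show "dih_a n [^]\<^bsub>G\<^esub> n = \<one>\<^bsub>G\<^esub>" "dih_b n [^]\<^bsub>G\<^esub> (2::nat) = \<one>\<^bsub>G\<^esub>"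
    unfolding G_def dih_a_def dih_b_def dihedral_group_def pow_word_class one_presented_group
      word_class_eq_iff
    by (rule rel, simp add: dihedral_relators_def numeral_2_eq_2)+
  interpret group G unfolding G_def by (rule group_dihedral_group)
  note c = dih_gens_in_carrier[of n, folded G_def]
  have "(dih_b n \<otimes>\<^bsub>G\<^esub> dih_a n \<otimes>\<^bsub>G\<^esub> inv\<^bsub>G\<^esub> (dih_b n)) \<otimes>\<^bsub>G\<^esub> dih_a n = \<one>\<^bsub>G\<^esub>"
    unfolding G_def dih_a_def dih_b_def dihedral_group_def inv_word_class mult_word_class
      one_presented_group word_class_eq_iff
    by (rule rel) (simp add: dihedral_relators_def)
  then show "dih_b n \<otimes>\<^bsub>G\<^esub> dih_a n \<otimes>\<^bsub>G\<^esub> inv\<^bsub>G\<^esub> (dih_b n) = inv\<^bsub>G\<^esub> (dih_a n)"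
    using c by (metis inv_closed inv_equality m_closed)
qed

lemma pres_eq_replicate_mod:
  assumes "pres_eq R (replicate n l) []"
  shows "pres_eq R (replicate k l) (replicate (k mod n) l)"
proof (induction k rule: less_induct)
  case (less k)
  show ?case
  proof (cases "n = 0 \<or> k < n")
    case True
    then show ?thesis by (auto simp: pres_eq.refl)
  next
    case False
    then have "pres_eq R (replicate k l) (replicate (k - n) l)"
      using pres_eq_append[OF assms pres_eq.refl, of "replicate (k - n) l"]
      by (simp flip: replicate_add)
    moreover have "pres_eq R (replicate (k - n) l) (replicate (k mod n) l)"
      using less[of "k - n"] False by (simp add: le_mod_geq)
    ultimately show ?thesis by (rule pres_eq.trans)
  qed
qed

lemma dihedral_normal_form:
  assumes "n \<ge> 1"
  shows "\<exists>i<n. \<exists>j<2. pres_eq (dihedral_relators n) w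
           (replicate i (Gen_a, True) @ replicate j (Gen_b, True))"
proof -
  define R where "R = dihedral_relators n"
  define a a' b b' where "a = (Gen_a, True)" and "a' = (Gen_a, False)"
    and "b = (Gen_b, True)" and "b' = (Gen_b, False)"
  note [trans] = pres_eq.trans
  note app = pres_eq_append[of R]
  have rel: "pres_eq R r []" if "r \<in> R" for r
    using pres_eq.relator[OF that, of "[]" "[]"] by simp
  have r1: "pres_eq R (replicate n a) []" and r2: "pres_eq R [b, b] []"
    and r3: "pres_eq R [b, a, b', a] []"
    by (rule rel, simp add: R_def dihedral_relators_def a_def b_def b'_def)+
  have can: "pres_eq R [a', a] []" "pres_eq R [a, a'] []" "pres_eq R [b', b] []"
    using pres_eq.cancel[of R "[]" Gen_a False "[]"] pres_eq.cancel[of R "[]" Gen_a True "[]"]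
      pres_eq.cancel[of R "[]" Gen_b False "[]"]
    by (auto simp: a_def a'_def b_def b'_def)
  have b': "pres_eq R [b'] [b]"
    using pres_eq_ctx[OF r2, of "[b']" "[]"] pres_eq_ctx[OF can(3), of "[]" "[b]"]
    by (simp, meson pres_eq.sym pres_eq.trans)
  have a': "pres_eq R [a'] (replicate (n - 1) a)"
  proof -
    have "[a'] @ replicate n a = [a', a] @ replicate (n - 1) a"
      using assms by (cases n) auto
    then show ?thesis
      using pres_eq_ctx[OF r1, of "[a']" "[]"]
        pres_eq_ctx[OF can(1), of "[]" "replicate (n - 1) a"]
      by (simp, meson pres_eq.sym pres_eq.trans)
  qed
  have ba: "pres_eq R [b, a] (replicate (n - 1) a @ [b])"
  proof -
    have "pres_eq R [b, a] ([b, a] @ [b', b])"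
      using pres_eq_ctx[OF can(3), of "[b, a]" "[]"] by (simp add: pres_eq.sym)
    also have "pres_eq R \<dots> ([b, a, b'] @ [a, a'] @ [b])"
      using pres_eq_ctx[OF can(2), of "[b, a, b']" "[b]"] by (simp add: pres_eq.sym)
    also have "pres_eq R \<dots> [a', b]"
      using pres_eq_ctx[OF r3, of "[]" "[a', b]"] by simp
    also have "pres_eq R \<dots> (replicate (n - 1) a @ [b])"
      using pres_eq_ctx[OF a', of "[]" "[b]"] by simp
    finally show ?thesis .
  qed
  have bai: "pres_eq R (b # replicate i a) (replicate ((n - 1) * i) a @ [b])" for i
  proof (induction i)
    case 0
    show ?case by (simp add: pres_eq.refl)
  next
    case (Suc i)
    have "pres_eq R (b # replicate (Suc i) a) (replicate (n - 1) a @ (b # replicate i a))"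
      using pres_eq_ctx[OF ba, of "[]" "replicate i a"] by simp
    also have "pres_eq R \<dots> (replicate (n - 1) a @ replicate ((n - 1) * i) a @ [b])"
      by (rule app[OF pres_eq.refl Suc])
    finally show ?case by (simp add: replicate_add)
  qed
  have "\<exists>i j. pres_eq R w (replicate i a @ replicate j b)"
  proof (induction w)
    case Nil
    show ?case by (rule exI[of _ 0], rule exI[of _ 0]) (simp add: pres_eq.refl)
  next
    case (Cons l w)
    then obtain i j where w: "pres_eq R w (replicate i a @ replicate j b)" by blast
    then have lw: "pres_eq R (l # w) ([l] @ replicate i a @ replicate j b)"
      using app[OF pres_eq.refl w, of "[l]"] by simp
    have bcase: "pres_eq R ([b] @ replicate i a @ replicate j b)
        (replicate ((n - 1) * i) a @ replicate (Suc j) b)"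
      using pres_eq_ctx[OF bai[of i], of "[]" "replicate j b"] by simp
    consider "l = a" | "l = a'" | "l = b" | "l = b'"
      unfolding a_def a'_def b_def b'_def by (cases l; cases "fst l"; cases "snd l") auto
    then show ?case
    proof cases
      case 1
      then show ?thesis using lw by (metis append_Cons append_Nil replicate_Suc)
    next
      case 2
      then have "pres_eq R (l # w) (replicate (n - 1) a @ replicate i a @ replicate j b)"
        using pres_eq.trans[OF lw] app[OF a' pres_eq.refl, of "replicate i a @ replicate j b"]
        by blast
      then show ?thesis by (metis append_assoc replicate_add)
    next
      case 3
      then show ?thesis using pres_eq.trans[OF lw] bcase by blast
    next
      case 4
      have "pres_eq R (l # w) ([b] @ replicate i a @ replicate j b)"
        using 4 pres_eq.trans[OF lw] app[OF b' pres_eq.refl, of "replicate i a @ replicate j b"]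
        by blast
      then show ?thesis using bcase pres_eq.trans by blast
    qed
  qed
  then obtain i j where "pres_eq R w (replicate i a @ replicate j b)" by blast
  also have "pres_eq R \<dots> (replicate (i mod n) a @ replicate (j mod 2) b)"
    by (rule app; rule pres_eq_replicate_mod) (use r1 r2 in \<open>auto simp: numeral_2_eq_2\<close>)
  finally show ?thesis
    using assms unfolding R_def a_def b_def
    by (metis mod_less_divisor less_eq_Suc_le One_nat_def zero_less_numeral)
qed

fun dih_letter :: "dih_gen \<times> bool \<Rightarrow> int \<times> int \<Rightarrow> int \<times> int" where
  "dih_letter (Gen_a, s) (i, e) = (i + (if s then 1 else - 1), e)"
| "dih_letter (Gen_b, s) (i, e) = (- i, - e)"

lemma pres_eq_dihedral_val:
  assumes "pres_eq (dihedral_relators n) u v"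
  shows "int n dvd fst (foldr dih_letter u (i, e)) - fst (foldr dih_letter v (i, e)) \<and>
    snd (foldr dih_letter u (i, e)) = snd (foldr dih_letter v (i, e))"
proof -
  define P where "P p q \<longleftrightarrow> int n dvd fst p - fst q \<and> snd p = snd q" for p q :: "int \<times> int"
  have letter: "P (dih_letter l p) (dih_letter l q)" if "P p q" for l p q
  proof -
    obtain g s where l: "l = (g, s)" by fastforce
    obtain i e j f where pq: "p = (i, e)" "q = (j, f)" by fastforce
    have "int n dvd i - j" "e = f" using that by (simp_all add: P_def pq)
    moreover from this have "int n dvd j - i" by (simp add: dvd_diff_commute)
    ultimately show ?thesis by (cases g) (simp_all add: P_def pq l)
  qed
  have word: "P (foldr dih_letter u p) (foldr dih_letter u q)" if "P p q" for u p q
    using that by (induction u) (auto intro: letter)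
  have rep: "(dih_letter (Gen_a, True) ^^ k) p = (fst p + int k, snd p)" for k p
    by (induction k) (auto simp: algebra_simps)
  have "P (foldr dih_letter u (i, e)) (foldr dih_letter v (i, e))"
    using assms
  proof (induction rule: pres_eq.induct)
    case (trans u v w)
    have "int n dvd (fst (foldr dih_letter u (i, e)) - fst (foldr dih_letter v (i, e))) +
        (fst (foldr dih_letter v (i, e)) - fst (foldr dih_letter w (i, e)))"
      using trans.IH unfolding P_def by (intro dvd_add) blast+
    then show ?case using trans.IH unfolding P_def by simp
  next
    case (cancel u g s v)
    obtain j f where *: "foldr dih_letter v (i, e) = (j, f)" by fastforce
    show ?case by (simp add: *, rule word) (cases g; simp add: P_def)
  next
    case (relator r u v)
    obtain j f where *: "foldr dih_letter v (i, e) = (j, f)" by fastforce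
    show ?case using relator
      by (simp add: *, intro word) (auto simp: P_def dihedral_relators_def rep)
  qed (auto simp: P_def dvd_diff_commute)
  then show ?thesis unfolding P_def by simp
qed

lemma order_dihedral_group:
  assumes "n \<ge> 1"
  shows "order (dihedral_group n) = 2 * n"
proof -
  let ?R = "dihedral_relators n"
  let ?nf = "\<lambda>(i, j). replicate i (Gen_a, True) @ replicate j (Gen_b, True)"
  have rep: "(dih_letter (Gen_a, True) ^^ k) p = (fst p + int k, snd p)" for k p
    by (induction k) (auto simp: algebra_simps)
  have "bij_betw (\<lambda>p. word_class ?R (?nf p)) ({..<n} \<times> {..<2}) (carrier (dihedral_group n))"
  proof (rule bij_betwI')
    fix p q :: "nat \<times> nat"
    assume p: "p \<in> {..<n} \<times> {..<2}" and q: "q \<in> {..<n} \<times> {..<2}"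
    obtain i j k l where pq: "p = (i, j)" "q = (k, l)" by fastforce
    have "p = q" if "pres_eq ?R (?nf p) (?nf q)"
    proof -
      have "j = 0 \<or> j = 1" "l = 0 \<or> l = 1" using p q pq by auto
      then have jl: "j = l" and d: "int n dvd int i - int k"
        using pres_eq_dihedral_val[OF that, of 0 1] by (auto simp: pq rep)
      have "\<bar>int i - int k\<bar> < int n" using p q pq by auto
      then have "i = k" using d by (metis dvd_imp_le_int linorder_not_less abs_of_nat
            diff_eq_eq add_0 of_nat_eq_iff)
      then show ?thesis using pq jl by simp
    qed
    then show "(word_class ?R (?nf p) = word_class ?R (?nf q)) = (p = q)"
      by (auto simp: word_class_eq_iff pres_eq.refl)
  next
    fix p :: "nat \<times> nat"
    show "word_class ?R (?nf p) \<in> carrier (dihedral_group n)"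
      by (simp add: dihedral_group_def carrier_presented_group)
  next
    fix X assume "X \<in> carrier (dihedral_group n)"
    then obtain w where "X = word_class ?R w"
      by (auto simp: dihedral_group_def carrier_presented_group)
    then show "\<exists>p\<in>{..<n} \<times> {..<2}. X = word_class ?R (?nf p)"
      using dihedral_normal_form[OF assms, of w]
      by (auto simp: word_class_eq_iff)
  qed
  then show ?thesis
    by (auto simp: order_def dest: bij_betw_same_card)
qed

lemma carrier_dihedral_group:
  assumes "n \<ge> 1"
  shows "carrier (dihedral_group n) =
    {dih_a n [^]\<^bsub>dihedral_group n\<^esub> i \<otimes>\<^bsub>dihedral_group n\<^esub> dih_b n [^]\<^bsub>dihedral_group n\<^esub> j |
      i j :: nat. i < n \<and> j < 2}"
proof -
  have "\<exists>i j. word_class (dihedral_relators n) w =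
      word_class (dihedral_relators n)
        (replicate i (Gen_a, True) @ replicate j (Gen_b, True)) \<and> i < n \<and> j < 2" for w
    using dihedral_normal_form[OF assms, of w] by (auto simp: word_class_eq_iff)
  then show ?thesis
    unfolding dihedral_group_def dih_a_def dih_b_def pow_word_class mult_word_class
      carrier_presented_group by blast
qed

end

theory Submission
  imports Defs "HOL-Algebra.Generated_Groups"
begin

text \<open>If \<open>n\<close> is a power of 2, then \<open>D\<^sub>n\<close> has exactly three maximal subgroups, all of index 2, and
  any two of them have the same intersection. A vertex lies in exactly one of them, two
  vertices in the same one are not co-maximal, and a subgroup of index 2 is co-maximal with every
  subgroup not contained in it; so a hyperedge picks one vertex below each maximal subgroup.
  If an odd prime \<open>p\<close> divides an even \<open>n\<close>, then \<open>\<langle>a\<^sup>p, b\<rangle>\<close> can be added to the three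
  subgroups of index 2, which gives a hyperedge with at least four elements. If \<open>n\<close> is odd, then
  \<open>{\<langle>a\<rangle>, \<langle>b\<rangle>}\<close> is a hyperedge.\<close>

section \<open>Co-maximal subgroups\<close>

lemma nontrivial_proper_subgroupsI:
  assumes "subgroup H G" "x \<in> H" "x \<noteq> \<one>\<^bsub>G\<^esub>" "y \<in> carrier G" "y \<notin> H"
  shows "H \<in> nontrivial_proper_subgroups G"
  using assms unfolding nontrivial_proper_subgroups_def by auto

context group
begin

text \<open>Inversion maps G onto itself and turns a factorization hk of the inverse of g into the
  factorization of g in the opposite order.\<close>

lemma comaximal_commute:
  assumes "subgroup H G" "subgroup K G" "H <#> K = carrier G"
  shows "K <#> H = carrier G"
proof
  show "K <#> H \<subseteq> carrier G"
    using assms(1,2) by (intro setmult_subset_G subgroup.subset)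
  show "carrier G \<subseteq> K <#> H"
  proof
    fix g assume g: "g \<in> carrier G"
    then have "inv g \<in> H <#> K" using assms(3) by simp
    then obtain h k where hk: "h \<in> H" "k \<in> K" "inv g = h \<otimes> k"
      by (auto simp: set_mult_def)
    then have "h \<in> carrier G" "k \<in> carrier G"
      using assms(1,2) by (auto dest: subgroup.mem_carrier)
    then have "g = inv k \<otimes> inv h"
      using hk g by (metis inv_inv inv_mult_group)
    moreover have "inv k \<in> K" "inv h \<in> H"
      using hk assms(1,2) by (simp_all add: subgroup.m_inv_closed)
    ultimately show "g \<in> K <#> H" unfolding set_mult_def by blast
  qed
qed

text \<open>Products of elements of M stay in M. This is the only obstruction to co-maximality used
  in the sequel.\<close>

lemma subset_subgroup_not_comaximal:
  assumes "subgroup M G" "M \<noteq> carrier G" "H \<subseteq> M" "K \<subseteq> M"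
  shows "H <#> K \<noteq> carrier G"
proof -
  have "H <#> K \<subseteq> M"
    using assms(1,3,4) by (auto simp: set_mult_def subgroup.m_closed subsetD)
  then show ?thesis using assms(1,2) subgroup.subset by blast
qed

text \<open>The last condition says that all elements outside M lie in one left coset. It expresses
  index 2 without counting cosets, in a form that can be checked on products.\<close>

definition index_two :: "'a set \<Rightarrow> bool" where
  "index_two M \<longleftrightarrow> subgroup M G \<and> M \<noteq> carrier G \<and>
     (\<forall>x\<in>carrier G - M. \<forall>y\<in>carrier G - M. inv x \<otimes> y \<in> M)"

text \<open>Fix h in H outside M. An element g of M is the product of the identity and g; any other
  g is h times \<open>inv h \<otimes> g\<close>, whose second factor lies in M.\<close>

lemma index_two_comaximal:
  assumes M: "index_two M" and H: "subgroup H G" "\<not> H \<subseteq> M"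
  shows "H <#> M = carrier G" "M <#> H = carrier G"
proof -
  have sM: "subgroup M G" using M by (simp add: index_two_def)
  obtain h where h: "h \<in> H" "h \<notin> M" using H by blast
  then have hc: "h \<in> carrier G" using subgroup.mem_carrier[OF H(1)] by simp
  show "H <#> M = carrier G"
  proof
    show "H <#> M \<subseteq> carrier G"
      using sM H(1) by (intro setmult_subset_G subgroup.subset)
    show "carrier G \<subseteq> H <#> M"
    proof
      fix g assume g: "g \<in> carrier G"
      show "g \<in> H <#> M"
      proof (cases "g \<in> M")
        case True
        then have "\<one> \<otimes> g \<in> H <#> M"
          using subgroup.one_closed[OF H(1)] unfolding set_mult_def by blast
        then show ?thesis using g by simp
      next
        case False
        then have "inv h \<otimes> g \<in> M" using M h hc g by (simp add: index_two_def)
        then have "h \<otimes> (inv h \<otimes> g) \<in> H <#> M"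
          using h unfolding set_mult_def by blast
        then show ?thesis using g hc by (simp flip: m_assoc)
      qed
    qed
  qed
  then show "M <#> H = carrier G" using comaximal_commute H sM by blast
qed

text \<open>Take x in M outside M' and y outside M. Both avoid M', so
  \<open>inv x \<otimes> y\<close> lies in M' and hence in M, which forces y into M.\<close>

lemma index_two_antichain:
  assumes "index_two M" "index_two M'" "M' \<subseteq> M"
  shows "M' = M"
proof (rule ccontr)
  assume "M' \<noteq> M"
  then obtain x where x: "x \<in> M" "x \<notin> M'" using assms(3) by blast
  have M: "subgroup M G" "M \<noteq> carrier G" using assms(1) by (simp_all add: index_two_def)
  obtain y where y: "y \<in> carrier G" "y \<notin> M"
    using subgroup.subset[OF M(1)] M(2) by blast
  have xc: "x \<in> carrier G" using subgroup.mem_carrier[OF M(1) x(1)] .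
  have "inv x \<otimes> y \<in> M'"
    using assms(2,3) x y xc unfolding index_two_def by blast
  then have "x \<otimes> (inv x \<otimes> y) \<in> M"
    using subgroup.m_closed[OF M(1) x(1)] assms(3) by blast
  then show False using xc y by (simp flip: m_assoc)
qed

text \<open>A finite group has finitely many vertices, so a pairwise co-maximal family lies in a
  maximal one, and these are the hyperedges.\<close>

lemma pairwise_comaximal_extend:
  assumes "finite (carrier G)" "E \<subseteq> comaximal_vertices G" "pairwise_comaximal G E"
  shows "\<exists>F\<in>comaximal_hyperedges G. E \<subseteq> F"
proof -
  let ?P = "{F. F \<subseteq> comaximal_vertices G \<and> pairwise_comaximal G F}"
  have "comaximal_vertices G \<subseteq> Pow (carrier G)"
    by (auto simp: comaximal_vertices_def nontrivial_proper_subgroups_def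
        dest: subgroup.mem_carrier)
  then have "finite (comaximal_vertices G)" using assms(1) finite_subset by blast
  then have "finite ?P" by simp
  then obtain F where "F \<in> ?P" "E \<subseteq> F" "\<forall>F'\<in>?P. F \<subseteq> F' \<longrightarrow> F = F'"
    using finite_has_maximal2[of ?P E] assms(2,3) by auto
  then have "F \<in> comaximal_hyperedges G" "E \<subseteq> F"
    unfolding comaximal_hyperedges_def by blast+
  then show ?thesis by blast
qed

text \<open>Sending a vertex to the member of \<open>Ms\<close> above it is a bijection from E onto
  \<open>Ms\<close>. It is injective because two vertices below the same member are not co-maximal,
  and surjective because a missed member could itself be added to E.\<close>

lemma card_comaximal_hyperedge:
  assumes Ms: "\<And>M. M \<in> Ms \<Longrightarrow> index_two M" "Ms \<subseteq> nontrivial_proper_subgroups G"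
    and two: "\<exists>M\<in>Ms. \<exists>M'\<in>Ms. M \<noteq> M'"
    and below: "\<And>H. subgroup H G \<Longrightarrow> H \<noteq> carrier G \<Longrightarrow> \<exists>M\<in>Ms. H \<subseteq> M"
    and inter: "\<And>M M' N. M \<in> Ms \<Longrightarrow> M' \<in> Ms \<Longrightarrow> N \<in> Ms \<Longrightarrow> M \<noteq> M' \<Longrightarrow> M \<inter> M' \<subseteq> N"
    and E: "E \<in> comaximal_hyperedges G"
  shows "card E = card Ms"
proof -
  have sub: "subgroup H G" "H \<noteq> carrier G" if "H \<in> comaximal_vertices G" for H
    using that by (auto simp: comaximal_vertices_def nontrivial_proper_subgroups_def)
  have Msub: "subgroup M G" "M \<noteq> carrier G" if "M \<in> Ms" for M
    using Ms(1)[OF that] by (simp_all add: index_two_def)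
  \<comment> \<open>A vertex below two members lies in their intersection, hence below every member.
    One of these lies above its co-maximal partner K, so the product of H and K is too
    small.\<close>
  have unique: "M = M'"
    if H: "H \<in> comaximal_vertices G" and M: "M \<in> Ms" "M' \<in> Ms" "H \<subseteq> M" "H \<subseteq> M'" for H M M'
  proof (rule ccontr)
    assume ne: "M \<noteq> M'"
    obtain K where K: "K \<in> nontrivial_proper_subgroups G" "H <#> K = carrier G"
      using H by (auto simp: comaximal_vertices_def)
    then obtain N where N: "N \<in> Ms" "K \<subseteq> N"
      using below[of K] by (auto simp: nontrivial_proper_subgroups_def)
    have "H \<subseteq> N" using inter[OF M(1,2) N(1) ne] M by blast
    then show False
      using subset_subgroup_not_comaximal[OF Msub[OF N(1)] _ N(2)] K by blast
  qed
  have EV: "E \<subseteq> comaximal_vertices G" and Ep: "pairwise_comaximal G E"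
    and Emax: "\<And>E'. E' \<subseteq> comaximal_vertices G \<Longrightarrow> E \<subset> E' \<Longrightarrow> \<not> pairwise_comaximal G E'"
    using E by (auto simp: comaximal_hyperedges_def)
  define f where "f H = (SOME M. M \<in> Ms \<and> H \<subseteq> M)" for H
  have f: "f H \<in> Ms" "H \<subseteq> f H" if "H \<in> E" for H
    using someI_ex[of "\<lambda>M. M \<in> Ms \<and> H \<subseteq> M"] below[of H] sub[of H] that EV
    unfolding f_def by blast+
  have "inj_on f E"
  proof (rule inj_onI, rule ccontr)
    fix H K assume HK: "H \<in> E" "K \<in> E" "f H = f K" "H \<noteq> K"
    then have "H <#> K = carrier G" using Ep by (simp add: pairwise_comaximal_def)
    moreover have "K \<subseteq> f H" using f HK by metis
    ultimately show False
      using subset_subgroup_not_comaximal[OF Msub[OF f(1)[OF HK(1)]] f(2)[OF HK(1)]] by blast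
  qed
  moreover have "f ` E = Ms"
  proof
    show "f ` E \<subseteq> Ms" using f by blast
    show "Ms \<subseteq> f ` E"
    proof (rule subsetI, rule ccontr)
      fix M assume M: "M \<in> Ms" "M \<notin> f ` E"
      \<comment> \<open>By uniqueness, \<open>f H\<close> is the only member above H. As it differs
        from M, the index-two criterion makes M co-maximal with all of E.\<close>
      have nsub: "\<not> H \<subseteq> M" if "H \<in> E" for H
        using unique[of H M "f H"] M f[OF that] that EV by blast
      \<comment> \<open>M has to be a vertex even when E is empty, so its partner is taken from
        \<open>Ms\<close>.\<close>
      obtain M' where M': "M' \<in> Ms" "M' \<noteq> M" using two by metis
      have "\<not> M' \<subseteq> M"
        using index_two_antichain Ms(1) M M' by blast
      then have "M <#> M' = carrier G"
        using index_two_comaximal(2)[OF Ms(1)[OF M(1)] Msub(1)[OF M'(1)]] by blast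
      then have "M \<in> comaximal_vertices G"
        using M M' Ms(2) by (auto simp: comaximal_vertices_def)
      then have "insert M E \<subseteq> comaximal_vertices G" using EV by simp
      moreover have "E \<subset> insert M E" using nsub by blast
      moreover have co: "H <#> M = carrier G" "M <#> H = carrier G" if "H \<in> E" for H
        using index_two_comaximal[OF Ms(1)[OF M(1)] sub(1) nsub] that EV by blast+
      then have "pairwise_comaximal G (insert M E)"
        using Ep co unfolding pairwise_comaximal_def by blast
      ultimately show False using Emax by blast
    qed
  qed
  ultimately show ?thesis by (metis card_image)
qed

end

section \<open>Subgroups of dihedral groups\<close>

text \<open>This detaches the argument from words and their classes. \<open>carrier_G\<close>
  provides normal forms, and \<open>order_G\<close> makes them unique.\<close>

locale dihedral = group G for G (structure) +
  fixes n :: nat and a b :: 'a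
  assumes n_pos: "n \<ge> 1"
    and a_closed [simp]: "a \<in> carrier G" and b_closed [simp]: "b \<in> carrier G"
    and a_pow: "a [^] n = \<one>" and b_square: "b \<otimes> b = \<one>"
    and conj_a: "b \<otimes> a \<otimes> inv b = inv a"
    and order_G: "order G = 2 * n"
    and carrier_G: "carrier G = {a [^] i \<otimes> b [^] j | i j :: nat. i < n \<and> j < 2}"
begin

text \<open>Integer exponents keep the multiplication rules linear, with no reduction modulo
  n.\<close>

definition rot :: "int \<Rightarrow> 'a" where "rot k = a [^] k"

definition reflect :: "int \<Rightarrow> 'a" where "reflect k = rot k \<otimes> b"

section \<open>Multiplication of rotations and reflections\<close>

lemma rot_closed [simp]: "rot k \<in> carrier G"
  by (simp add: rot_def)

lemma refl_closed [simp]: "reflect k \<in> carrier G"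
  by (simp add: reflect_def)

lemma rot_0: "rot 0 = \<one>"
  by (simp add: rot_def)

lemma rot_rot: "rot k \<otimes> rot l = rot (k + l)"
  by (simp add: rot_def int_pow_mult)

lemma inv_rot: "inv (rot k) = rot (- k)"
  by (simp add: rot_def int_pow_neg)

lemma rot_refl: "rot k \<otimes> reflect l = reflect (k + l)"
  by (simp add: reflect_def rot_rot flip: m_assoc)

lemma inv_b: "inv b = b"
  using b_square by (simp add: inv_equality)

lemma b_a: "b \<otimes> a = inv a \<otimes> b"
proof -
  have "b \<otimes> a = (b \<otimes> a \<otimes> inv b) \<otimes> b" by (simp add: m_assoc)
  then show ?thesis by (simp add: conj_a)
qed

lemma b_inv_a: "b \<otimes> inv a = a \<otimes> b"
proof -
  have "inv (b \<otimes> a) = inv (inv a \<otimes> b)" by (simp only: b_a)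
  then have "inv a \<otimes> b = b \<otimes> a" by (simp add: inv_mult_group inv_b)
  have "a \<otimes> (b \<otimes> a) \<otimes> inv a = a \<otimes> (inv a \<otimes> b) \<otimes> inv a"
    by (simp only: b_a)
  then show ?thesis
    by (metis a_closed b_closed inv_closed inv_solve_left inv_solve_right m_assoc m_closed)
qed

lemma b_rot: "b \<otimes> rot k = reflect (- k)"
proof (induction k rule: int_induct[of _ 0])
  case base
  show ?case by (simp add: reflect_def rot_0)
next
  case (step1 i)
  have "b \<otimes> rot (i + 1) = b \<otimes> a \<otimes> rot i"
    using rot_rot[of 1 i] by (simp add: rot_def m_assoc int_pow_1 add.commute)
  also have "\<dots> = inv a \<otimes> (b \<otimes> rot i)" by (simp add: b_a m_assoc)
  also have "\<dots> = rot (- 1) \<otimes> reflect (- i)"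
    using step1.IH by (simp add: rot_def int_pow_neg)
  finally show ?case by (simp add: rot_refl add.commute)
next
  case (step2 i)
  have "b \<otimes> rot (i - 1) = b \<otimes> inv a \<otimes> rot i"
    using rot_rot[of "-1" i] by (simp add: rot_def m_assoc int_pow_neg)
  also have "\<dots> = a \<otimes> (b \<otimes> rot i)" by (simp add: b_inv_a m_assoc)
  also have "\<dots> = rot 1 \<otimes> reflect (- i)"
    using step2.IH by (simp add: rot_def)
  finally show ?case by (simp add: rot_refl)
qed

lemma refl_rot: "reflect k \<otimes> rot l = reflect (k - l)"
proof -
  have "reflect k \<otimes> rot l = rot k \<otimes> (b \<otimes> rot l)" by (simp add: reflect_def m_assoc)
  then show ?thesis by (simp add: b_rot rot_refl)
qed

lemma refl_refl: "reflect k \<otimes> reflect l = rot (k - l)"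
proof -
  have "reflect k \<otimes> reflect l = (reflect k \<otimes> rot l) \<otimes> b" by (simp add: reflect_def[of l] m_assoc)
  also have "\<dots> = rot (k - l)" by (simp only: refl_rot) (simp add: reflect_def m_assoc b_square)
  finally show ?thesis .
qed

lemma inv_refl: "inv (reflect k) = reflect k"
  by (rule inv_equality) (simp_all add: refl_refl rot_0)

lemmas mult_simps = rot_rot rot_refl refl_rot refl_refl inv_rot inv_refl

section \<open>Normal forms and equality of elements\<close>

lemma carrier_cases:
  assumes "x \<in> carrier G"
  obtains k where "x = rot k" | k where "x = reflect k"
proof -
  obtain i j :: nat where ij: "x = a [^] i \<otimes> b [^] j" "j < 2"
    using assms carrier_G by blast
  have "j = 0 \<or> j = 1" using ij by auto
  then have "x = rot (int i) \<or> x = reflect (int i)"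
    using ij by (auto simp: rot_def reflect_def int_pow_int)
  then show ?thesis using that by blast
qed

lemma rot_multiple: "rot (int n * k) = \<one>"
proof -
  have "rot (int n * k) = (a [^] int n) [^] k" by (simp add: rot_def int_pow_pow)
  then show ?thesis by (simp add: int_pow_int a_pow)
qed

text \<open>The map is onto G, and its domain has 2n elements, as many as G.\<close>

lemma normal_form_inj:
  "inj_on (\<lambda>(i, j). a [^] i \<otimes> b [^] j) ({..<n} \<times> {..<2::nat})"
proof (rule eq_card_imp_inj_on)
  have img: "(\<lambda>(i, j). a [^] i \<otimes> b [^] j) ` ({..<n} \<times> {..<2::nat}) = carrier G"
  proof
    show "(\<lambda>(i, j). a [^] i \<otimes> b [^] j) ` ({..<n} \<times> {..<2::nat}) \<subseteq> carrier G"
      by clarsimp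
    show "carrier G \<subseteq> (\<lambda>(i, j). a [^] i \<otimes> b [^] j) ` ({..<n} \<times> {..<2::nat})"
    proof
      fix x assume "x \<in> carrier G"
      then obtain i j :: nat where "i < n" "j < 2" "x = a [^] i \<otimes> b [^] j" using carrier_G by blast
      then show "x \<in> (\<lambda>(i, j). a [^] i \<otimes> b [^] j) ` ({..<n} \<times> {..<2::nat})"
        by (intro image_eqI[of _ _ "(i, j)"]) simp_all
    qed
  qed
  show "card ((\<lambda>(i, j). a [^] i \<otimes> b [^] j) ` ({..<n} \<times> {..<2::nat}))
      = card ({..<n} \<times> {..<2::nat})"
    unfolding img using order_G by (simp add: order_def card_cartesian_product)
qed simp

lemma finite_G: "finite (carrier G)"
  using order_G n_pos by (metis card.infinite mult_is_0 not_one_le_zero order_def zero_neq_numeral)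

lemma rot_mod: "rot k = a [^] nat (k mod int n)"
proof -
  have "rot k = rot (int n * (k div int n)) \<otimes> rot (k mod int n)"
    by (simp add: rot_rot)
  also have "\<dots> = rot (int (nat (k mod int n)))"
    using n_pos by (simp add: rot_multiple)
  finally show ?thesis by (simp add: rot_def int_pow_int)
qed

lemma mod_n_less: "nat (k mod int n) < n"
  using n_pos by (simp add: nat_less_iff)

lemma rot_eq_iff: "rot k = rot l \<longleftrightarrow> int n dvd k - l"
proof
  assume "rot k = rot l"
  then have "a [^] nat (k mod int n) \<otimes> b [^] (0::nat) = a [^] nat (l mod int n) \<otimes> b [^] (0::nat)"
    by (simp add: rot_mod)
  then have "nat (k mod int n) = nat (l mod int n)"
    using inj_onD[OF normal_form_inj, of "(nat (k mod int n), 0)" "(nat (l mod int n), 0)"]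
      mod_n_less by auto
  then have "k mod int n = l mod int n"
    using n_pos by (simp add: nat_eq_iff split: if_splits)
  then show "int n dvd k - l" by (simp add: mod_eq_dvd_iff)
next
  assume "int n dvd k - l"
  then show "rot k = rot l" by (simp add: rot_mod mod_eq_dvd_iff[symmetric])
qed

lemma rot_neq_refl: "rot k \<noteq> reflect l"
proof
  assume "rot k = reflect l"
  then have "a [^] nat (k mod int n) \<otimes> b [^] (0::nat) = a [^] nat (l mod int n) \<otimes> b [^] (1::nat)"
    by (simp add: rot_mod reflect_def)
  then show False
    using inj_onD[OF normal_form_inj, of "(nat (k mod int n), 0)" "(nat (l mod int n), 1)"]
      mod_n_less by auto
qed

lemma refl_eq_iff: "reflect k = reflect l \<longleftrightarrow> int n dvd k - l"
  by (simp add: reflect_def rot_eq_iff)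

lemma refl_neq_one: "reflect k \<noteq> \<one>"
  using rot_neq_refl[of 0 k] by (simp add: rot_0)

text \<open>By Bezout, uk is congruent to 1 modulo n for some u, so the power of
  \<open>rot k\<close> with exponent \<open>u * l\<close> is \<open>rot l\<close>.\<close>

lemma rot_mem_of_coprime:
  assumes "subgroup H G" "rot k \<in> H" "coprime k (int n)"
  shows "rot l \<in> H"
proof -
  obtain u v where uv: "u * k + v * int n = 1"
    using bezout_int[of k "int n"] assms(3) by (auto simp: coprime_iff_gcd_eq_1)
  have "rot k [^] (u * l) \<in> H" using assms(1,2) subgroup_int_pow_closed by blast
  moreover have "rot k [^] (u * l) = rot (k * (u * l))" by (simp add: rot_def int_pow_pow)
  moreover have "rot (k * (u * l)) = rot l"
  proof -
    have "k * (u * l) - l = (u * k + v * int n) * l - v * int n * l - l"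
      by (simp add: algebra_simps)
    also have "\<dots> = int n * (- (v * l))" by (simp add: uv)
    finally show ?thesis unfolding rot_eq_iff by simp
  qed
  ultimately show ?thesis by simp
qed

section \<open>The rotation subgroup and the dihedral subgroups\<close>

definition rotations :: "'a set" where "rotations = range rot"

text \<open>For d dividing n this is the subgroup generated by a^d and a^s b. Listing its elements
  reduces membership to divisibility.\<close>

definition dih_sub :: "int \<Rightarrow> int \<Rightarrow> 'a set" where
  "dih_sub d s = {rot k | k. d dvd k} \<union> {reflect k | k. d dvd k - s}"

lemma rot_in_rotations [simp]: "rot k \<in> rotations"
  by (simp add: rotations_def)

lemma refl_notin_rotations [simp]: "reflect k \<notin> rotations"
  using rot_neq_refl by (metis imageE rotations_def)

text \<open>The exponent of a rotation is determined only modulo n; since d divides n, divisibility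
  by d does not depend on the representative.\<close>

lemma rot_mem_dih_sub:
  assumes "d dvd int n"
  shows "rot k \<in> dih_sub d s \<longleftrightarrow> d dvd k"
proof -
  have "d dvd k" if "int n dvd k - l" "d dvd l" for l
    using that assms by (metis dvd_trans dvd_add_right_iff diff_add_cancel)
  moreover have "rot k \<in> dih_sub d s \<longleftrightarrow> (\<exists>l. int n dvd k - l \<and> d dvd l)"
    unfolding dih_sub_def by (auto simp: rot_eq_iff rot_neq_refl)
  ultimately show ?thesis by (metis diff_self dvd_0_right)
qed

lemma refl_mem_dih_sub:
  assumes "d dvd int n"
  shows "reflect k \<in> dih_sub d s \<longleftrightarrow> d dvd k - s"
proof -
  have "d dvd k - s" if "int n dvd k - l" "d dvd l - s" for l
    using dvd_add[OF dvd_trans[OF assms that(1)] that(2)] by simp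
  moreover have "reflect k \<in> dih_sub d s \<longleftrightarrow> (\<exists>l. int n dvd k - l \<and> d dvd l - s)"
    unfolding dih_sub_def by (auto simp: refl_eq_iff rot_neq_refl[symmetric])
  ultimately show ?thesis by (metis diff_self dvd_0_right)
qed

lemma subgroup_rotations: "subgroup rotations G"
  by (rule subgroupI) (auto simp: rotations_def mult_simps)

lemma subgroup_dih_sub:
  assumes d: "d dvd int n"
  shows "subgroup (dih_sub d s) G"
proof (rule subgroupI)
  show sub: "dih_sub d s \<subseteq> carrier G" by (auto simp: dih_sub_def)
  show "dih_sub d s \<noteq> {}" using rot_mem_dih_sub[OF d, of 0 s] by auto
  fix x assume x: "x \<in> dih_sub d s"
  then have xc: "x \<in> carrier G" using sub by blast
  from xc show "inv x \<in> dih_sub d s"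
    by (rule carrier_cases)
       (use x in \<open>simp_all add: mult_simps rot_mem_dih_sub[OF d] refl_mem_dih_sub[OF d]\<close>)
  fix y assume y: "y \<in> dih_sub d s"
  then have yc: "y \<in> carrier G" using sub by blast
  note mem = rot_mem_dih_sub[OF d] refl_mem_dih_sub[OF d]
  from xc show "x \<otimes> y \<in> dih_sub d s"
  proof (rule carrier_cases)
    fix k assume k: "x = rot k"
    from yc show ?thesis
    proof (rule carrier_cases)
      fix l assume "y = reflect l"
      then show ?thesis using x y k dvd_add[of d k "l - s"] by (simp add: mult_simps mem add_diff_eq)
    qed (use x y k in \<open>simp add: mult_simps mem\<close>)
  next
    fix k assume k: "x = reflect k"
    from yc show ?thesis
    proof (rule carrier_cases)
      fix l assume "y = rot l"
      then show ?thesis using x y k dvd_diff[of d "k - s" l]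
        by (simp add: mult_simps mem algebra_simps)
    next
      fix l assume "y = reflect l"
      then show ?thesis using x y k dvd_diff[of d "k - s" "l - s"] by (simp add: mult_simps mem)
    qed
  qed
qed

lemma rotations_nontrivial_proper:
  assumes "n \<ge> 2"
  shows "rotations \<in> nontrivial_proper_subgroups G"
  by (rule nontrivial_proper_subgroupsI[of _ _ "rot 1" "reflect 0"])
     (use assms rot_eq_iff[of 1 0] in \<open>auto simp: subgroup_rotations rot_0\<close>)

lemma dih_sub_nontrivial_proper:
  assumes "d dvd int n" "\<not> d dvd 1"
  shows "dih_sub d s \<in> nontrivial_proper_subgroups G"
  by (rule nontrivial_proper_subgroupsI[of _ _ "reflect s" "rot 1"])
     (use assms in \<open>simp_all add: subgroup_dih_sub rot_mem_dih_sub refl_mem_dih_sub refl_neq_one\<close>)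

lemma index_two_rotations: "index_two rotations"
  unfolding index_two_def
proof (intro conjI ballI subgroup_rotations)
  show "rotations \<noteq> carrier G" using refl_closed refl_notin_rotations by metis
  fix x y assume "x \<in> carrier G - rotations" "y \<in> carrier G - rotations"
  then obtain k l where "x = reflect k" "y = reflect l"
    by (metis Diff_iff carrier_cases rot_in_rotations)
  then show "inv x \<otimes> y \<in> rotations" by (simp add: mult_simps)
qed

text \<open>Membership is a parity condition, and two wrong parities cancel in
  \<open>inv x \<otimes> y\<close>.\<close>

lemma index_two_dih_sub:
  assumes "even n"
  shows "index_two (dih_sub 2 s)"
proof -
  have d: "2 dvd int n" using assms by simp
  note mem = rot_mem_dih_sub[OF d] refl_mem_dih_sub[OF d]
  show ?thesis unfolding index_two_def
  proof (intro conjI ballI subgroup_dih_sub[OF d])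
    show "dih_sub 2 s \<noteq> carrier G"
      using mem(1)[of 1 s] rot_closed[of 1] by (metis odd_one)
    fix x y assume xy: "x \<in> carrier G - dih_sub 2 s" "y \<in> carrier G - dih_sub 2 s"
    from xy have "x \<in> carrier G" "y \<in> carrier G" by auto
    then show "inv x \<otimes> y \<in> dih_sub 2 s"
      by (elim carrier_cases) (use xy in \<open>auto simp: mult_simps mem\<close>)
  qed
qed

section \<open>Containment in the subgroups of index two\<close>

lemma subgroup_eq_carrier:
  assumes H: "subgroup H G" "\<And>k. rot k \<in> H" "reflect s \<in> H"
  shows "H = carrier G"
proof
  show "H \<subseteq> carrier G" using subgroup.subset[OF H(1)] .
  have "reflect k \<in> H" for k
    using subgroup.m_closed[OF H(1) H(2)[of "k - s"] H(3)] by (simp add: mult_simps)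
  then show "carrier G \<subseteq> H" using H(2) carrier_cases by (metis subsetI)
qed

text \<open>An odd exponent is coprime to a power of 2, so a rotation with such an exponent
  generates all rotations and, together with one reflection, all of G. A proper H containing
  \<open>reflect s\<close> thus has only even rotations, and products of two reflections show that
  all its reflections have exponents of the parity of s.\<close>

lemma subset_index_two_subgroup:
  assumes n: "n = 2 ^ \<alpha>" and H: "subgroup H G" "H \<noteq> carrier G"
  shows "H \<subseteq> rotations \<or> H \<subseteq> dih_sub 2 0 \<or> H \<subseteq> dih_sub 2 1"
proof (cases "H \<subseteq> rotations")
  case False
  then obtain x where x: "x \<in> H" "x \<notin> rotations" by blast
  obtain s where s: "reflect s \<in> H"
    using carrier_cases[OF subgroup.mem_carrier[OF H(1) x(1)]] x rot_in_rotations by metis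
  have rot: "even k" if "rot k \<in> H" for k
  proof (rule ccontr)
    assume "odd k"
    then have "coprime k (int n)" by (simp add: n)
    then show False using subgroup_eq_carrier[OF H(1) rot_mem_of_coprime[OF H(1) that] s] H(2) by simp
  qed
  have refl: "even (k - s)" if "reflect k \<in> H" for k
    using rot[of "k - s"] subgroup.m_closed[OF H(1) that s] by (simp add: refl_refl)
  have "H \<subseteq> dih_sub 2 t" if "even (s - t)" for t
  proof
    fix x assume x: "x \<in> H"
    then have "x \<in> carrier G" using subgroup.mem_carrier[OF H(1)] by blast
    then show "x \<in> dih_sub 2 t"
    proof (rule carrier_cases)
      fix k assume k: "x = rot k"
      then have "even k" using x rot by simp
      then show ?thesis using k by (auto simp: dih_sub_def)
    next
      fix k assume k: "x = reflect k"
      then have "even (k - s)" using x refl by simp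
      then have "even (k - t)" using that by simp
      then show ?thesis using k unfolding dih_sub_def by blast
    qed
  qed
  \<comment> \<open>The parity of s selects one of the two subgroups.\<close>
  from this[of 0] this[of 1] show ?thesis by auto
qed simp

text \<open>The witnesses are \<open>rot 1\<close> and \<open>reflect s\<close>; the premise of the
  second claim says that s and t have opposite parity.\<close>

lemma not_subset_index_two:
  assumes "even n"
  shows "\<not> rotations \<subseteq> dih_sub 2 s"
    "odd s \<longleftrightarrow> even t \<Longrightarrow> \<not> dih_sub 2 s \<subseteq> dih_sub 2 t"
proof -
  have d: "2 dvd int n" using assms by simp
  note mem = rot_mem_dih_sub[OF d] refl_mem_dih_sub[OF d]
  show "\<not> rotations \<subseteq> dih_sub 2 s"
    using mem(1)[of 1 s] by (metis odd_one rot_in_rotations subsetD)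
  show "\<not> dih_sub 2 s \<subseteq> dih_sub 2 t" if "odd s \<longleftrightarrow> even t"
    using mem(2)[of s s] mem(2)[of s t] that by auto
qed

section \<open>Hyperedges\<close>

lemma hyperedge_card_power_two:
  assumes n: "n = 2 ^ \<alpha>" "\<alpha> > 0" and E: "E \<in> comaximal_hyperedges G"
  shows "card E = 3"
proof -
  let ?Ms = "{rotations, dih_sub 2 0, dih_sub 2 1}"
  have ev: "even n" and n2: "n \<ge> 2" using n self_le_power[of 2 \<alpha>] by auto
  have d: "2 dvd int n" using ev by simp
  note mem = rot_mem_dih_sub[OF d] refl_mem_dih_sub[OF d]
  note ns = not_subset_index_two[OF ev]
  have ne: "rotations \<noteq> dih_sub 2 0" "rotations \<noteq> dih_sub 2 1" "dih_sub 2 0 \<noteq> dih_sub 2 1"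
    using ns(1)[of 0] ns(1)[of 1] ns(2)[of 0 1] by simp_all
  have "card E = card ?Ms"
  proof (rule card_comaximal_hyperedge[OF _ _ _ _ _ E])
    show "index_two M" if "M \<in> ?Ms" for M
      using that index_two_rotations index_two_dih_sub[OF ev] by blast
    show "?Ms \<subseteq> nontrivial_proper_subgroups G"
      using rotations_nontrivial_proper[OF n2] dih_sub_nontrivial_proper[OF d] by simp
    show "\<exists>M\<in>?Ms. \<exists>M'\<in>?Ms. M \<noteq> M'" using ne by blast
    show "\<exists>M\<in>?Ms. H \<subseteq> M" if "subgroup H G" "H \<noteq> carrier G" for H
      using subset_index_two_subgroup[OF n(1) that] by blast
    fix M M' N assume M: "M \<in> ?Ms" "M' \<in> ?Ms" "N \<in> ?Ms" "M \<noteq> M'"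
    \<comment> \<open>Any two of the three subgroups meet exactly in the even rotations, which lie
      in all of them.\<close>
    show "M \<inter> M' \<subseteq> N"
    proof
      fix x assume x: "x \<in> M \<inter> M'"
      have "x \<in> carrier G"
        using x M subgroup.subset[OF subgroup_rotations] subgroup.subset[OF subgroup_dih_sub[OF d]]
        by blast
      then show "x \<in> N"
        by (elim carrier_cases) (use x M in \<open>auto simp: mem\<close>)
    qed
  qed
  then show ?thesis using ne by simp
qed

lemma hyperedge_odd:
  assumes "odd n" "n \<ge> 2"
  shows "\<exists>E\<in>comaximal_hyperedges G. card E = 2"
proof -
  \<comment> \<open>With d = n only the identity and b remain, so this is the subgroup generated by
    b.\<close>
  let ?B = "dih_sub (int n) 0"
  let ?E = "{rotations, ?B}"
  have B: "?B \<in> nontrivial_proper_subgroups G" "subgroup ?B G"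
    using assms by (auto intro: dih_sub_nontrivial_proper subgroup_dih_sub)
  have A: "rotations \<in> nontrivial_proper_subgroups G"
    using rotations_nontrivial_proper assms by simp
  have nsub: "\<not> ?B \<subseteq> rotations"
    using refl_mem_dih_sub[of "int n" 0 0] refl_notin_rotations[of 0] by auto
  then have ne: "?B \<noteq> rotations" by blast
  note AB = index_two_comaximal[OF index_two_rotations B(2) nsub]
  have V: "?E \<subseteq> comaximal_vertices G"
    using A B AB by (auto simp: comaximal_vertices_def)
  have pw: "pairwise_comaximal G ?E"
    using AB by (auto simp: pairwise_comaximal_def)
  have no_third: False
    if K: "subgroup K G" "K \<noteq> carrier G" and KA: "rotations <#> K = carrier G"
      and KB: "?B <#> K = carrier G" for K
  proof -
    \<comment> \<open>Write \<open>rot k\<close> as hx with h in \<open>?B\<close> and x in K: x is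
      \<open>rot k\<close> if h is the identity, and b times \<open>rot k\<close> if h is b.\<close>
    have mem: "rot k \<in> K \<or> reflect (- k) \<in> K" for k
    proof -
      have "rot k \<in> ?B <#> K" using KB by simp
      then obtain h x where hx: "h \<in> ?B" "x \<in> K" "rot k = h \<otimes> x"
        by (auto simp: set_mult_def)
      have "h = rot 0 \<or> h = reflect 0"
        using hx(1) by (auto simp: dih_sub_def rot_eq_iff refl_eq_iff)
      moreover have xc: "x \<in> carrier G" using hx(2) subgroup.mem_carrier[OF K(1)] by blast
      moreover have "x = reflect (- k)" if "h = reflect 0"
      proof -
        have "reflect 0 \<otimes> rot k = (reflect 0 \<otimes> reflect 0) \<otimes> x"
          using hx(3) that xc by (simp add: m_assoc)
        then show ?thesis using xc by (simp add: mult_simps rot_0)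
      qed
      ultimately show ?thesis using hx(2,3) by (auto simp: rot_0)
    qed
    \<comment> \<open>If K contains neither a nor its inverse, it contains the reflections with
      exponents 1 and -1. Their product is \<open>rot 2\<close>, which generates the rotations
      because n is odd. Either way K contains all rotations and absorbs the product with
      them.\<close>
    have "\<exists>k. rot k \<in> K \<and> coprime k (int n)"
    proof (cases "rot 1 \<in> K \<or> rot (- 1) \<in> K")
      case True
      then show ?thesis by (metis coprime_1_left coprime_minus_left_iff)
    next
      case False
      then have "reflect (- 1) \<in> K" "reflect 1 \<in> K" using mem[of 1] mem[of "- 1"] by auto
      then have "rot 2 \<in> K" using subgroup.m_closed[OF K(1)] refl_refl[of 1 "- 1"] by fastforce
      moreover have "coprime 2 (int n)" using assms(1) by simp
      ultimately show ?thesis by blast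
    qed
    then have rot: "rot l \<in> K" for l using rot_mem_of_coprime[OF K(1)] by blast
    have "rotations \<subseteq> K" using rot by (auto simp: rotations_def)
    then show False using subset_subgroup_not_comaximal[OF K, of rotations K] KA by blast
  qed
  have "\<not> pairwise_comaximal G E'" if E': "E' \<subseteq> comaximal_vertices G" "?E \<subset> E'" for E'
  proof
    assume p: "pairwise_comaximal G E'"
    obtain K where K: "K \<in> E'" "K \<noteq> rotations" "K \<noteq> ?B" using E'(2) by blast
    then have "rotations <#> K = carrier G" "?B <#> K = carrier G"
      using p E'(2) unfolding pairwise_comaximal_def by blast+
    moreover have "subgroup K G" "K \<noteq> carrier G"
      using K(1) E'(1) by (auto simp: comaximal_vertices_def nontrivial_proper_subgroups_def)
    ultimately show False using no_third by blast
  qed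
  then have "?E \<in> comaximal_hyperedges G"
    using V pw by (auto simp: comaximal_hyperedges_def)
  moreover have "card ?E = 2" using ne by simp
  ultimately show ?thesis by blast
qed

text \<open>Each pair among the four subgroups includes one of index 2, so co-maximality reduces to
  non-containment. The family is not claimed to be maximal; extending it to a hyperedge only adds
  elements.\<close>

lemma hyperedge_even:
  assumes "even n" "n \<ge> 2" "p dvd n" "odd p" "p \<noteq> 1"
  shows "\<exists>E\<in>comaximal_hyperedges G. card E \<ge> 4"
proof -
  let ?P = "dih_sub (int p) 0"
  let ?Ms = "{rotations, dih_sub 2 0, dih_sub 2 1}"
  let ?E = "insert ?P ?Ms"
  have d: "2 dvd int n" "int p dvd int n" using assms by simp_all
  note mem = rot_mem_dih_sub[OF d(1)] refl_mem_dih_sub[OF d(1)]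
    rot_mem_dih_sub[OF d(2)] refl_mem_dih_sub[OF d(2)]
  note ns = not_subset_index_two[OF assms(1)]
  have P: "?P \<in> nontrivial_proper_subgroups G" "subgroup ?P G"
    using assms d by (auto intro!: dih_sub_nontrivial_proper subgroup_dih_sub)
  have nt: "?E \<subseteq> nontrivial_proper_subgroups G"
    using P rotations_nontrivial_proper[OF assms(2)] dih_sub_nontrivial_proper[OF d(1)] by simp
  have sg: "subgroup H G" if "H \<in> ?E" for H
    using that nt by (auto simp: nontrivial_proper_subgroups_def)
  have idx: "index_two M" if "M \<in> ?Ms" for M
    using that index_two_rotations index_two_dih_sub[OF assms(1)] by blast
  \<comment> \<open>Elements of \<open>?P\<close> outside each index-two subgroup: b escapes two of
    them, and a^p escapes the third because p is odd.\<close>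
  have "reflect 0 \<in> ?P" "reflect 0 \<notin> rotations" "reflect 0 \<notin> dih_sub 2 1"
    "rot (int p) \<in> ?P" "rot (int p) \<notin> dih_sub 2 0"
    using assms by (simp_all add: mem)
  then have Pn: "\<not> ?P \<subseteq> M" if "M \<in> ?Ms" for M using that by blast
  have Mn: "\<not> M \<subseteq> M'" if "M \<in> ?Ms" "M' \<in> ?Ms" "M \<noteq> M'" for M M'
    using that index_two_antichain[OF idx[OF that(2)] idx[OF that(1)]] by metis
  have co: "H <#> K = carrier G" if HK: "H \<in> ?E" "K \<in> ?E" "H \<noteq> K" for H K
  proof (cases "K \<in> ?Ms")
    case True
    then have "\<not> H \<subseteq> K" using HK Pn[of K] Mn[of H K] by blast
    then show ?thesis using index_two_comaximal(1)[OF idx[OF True] sg[OF HK(1)]] by blast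
  next
    case False
    then have "K = ?P" "H \<in> ?Ms" using HK by blast+
    then show ?thesis using index_two_comaximal(2)[OF idx P(2) Pn] by blast
  qed
  have ne: "rotations \<noteq> dih_sub 2 0" "rotations \<noteq> dih_sub 2 1" "dih_sub 2 0 \<noteq> dih_sub 2 1"
    using ns(1)[of 0] ns(1)[of 1] ns(2)[of 0 1] by simp_all
  have PM: "?P \<notin> ?Ms" using Pn by blast
  have "?E \<subseteq> comaximal_vertices G"
  proof
    fix H assume H: "H \<in> ?E"
    obtain K where "K \<in> ?E" "K \<noteq> H" using ne by blast
    then show "H \<in> comaximal_vertices G"
      using H co[of H K] nt by (auto simp: comaximal_vertices_def)
  qed
  moreover have "pairwise_comaximal G ?E"
    using co unfolding pairwise_comaximal_def by blast
  ultimately obtain F where F: "F \<in> comaximal_hyperedges G" "?E \<subseteq> F"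
    using pairwise_comaximal_extend[OF finite_G] by metis
  have "F \<subseteq> Pow (carrier G)"
    using F(1) by (auto simp: comaximal_hyperedges_def comaximal_vertices_def
        nontrivial_proper_subgroups_def dest: subgroup.mem_carrier)
  then have "finite F" using finite_G finite_subset by blast
  moreover have "card ?E = 4" using ne PM by simp
  ultimately show ?thesis using F card_mono by metis
qed

end

section \<open>Application to the presented dihedral group\<close>

lemma dihedral_dihedral_group:
  assumes "n \<ge> 1"
  shows "dihedral (dihedral_group n) n (dih_a n) (dih_b n)"
proof -
  interpret group "dihedral_group n" by (rule group_dihedral_group)
  show ?thesis
  proof (unfold_locales)
    show "dih_b n \<otimes>\<^bsub>dihedral_group n\<^esub> dih_b n = \<one>\<^bsub>dihedral_group n\<^esub>"
      using dihedral_relations(2)[of n] dih_gens_in_carrier(2)[of n]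
      by (simp add: numeral_2_eq_2)
    show "carrier (dihedral_group n) =
      {dih_a n [^]\<^bsub>dihedral_group n\<^esub> i \<otimes>\<^bsub>dihedral_group n\<^esub> dih_b n [^]\<^bsub>dihedral_group n\<^esub> j |
        i j :: nat. i < n \<and> j < 2}"
      using assms by (rule carrier_dihedral_group)
  qed (use assms in \<open>simp_all add: dihedral_relations dih_gens_in_carrier order_dihedral_group\<close>)
qed

lemma power_two_or_odd_divisor:
  fixes n :: nat
  assumes "n \<ge> 1"
  shows "(\<exists>\<alpha>. n = 2 ^ \<alpha>) \<or> (\<exists>p. p dvd n \<and> odd p \<and> p \<noteq> 1)"
  using assms
proof (induction n rule: less_induct)
  case (less n)
  show ?case
  proof (cases "even n")
    case True
    then obtain m where m: "n = 2 * m" by blast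
    then have "(\<exists>\<alpha>. m = 2 ^ \<alpha>) \<or> (\<exists>p. p dvd m \<and> odd p \<and> p \<noteq> 1)"
      using less by simp
    then show ?thesis using m by (metis dvd_mult power_Suc)
  next
    case False
    \<comment> \<open>An odd n is its own odd divisor, except that n = 1 counts as the zeroth power
      of 2.\<close>
    then show ?thesis by (metis dvd_refl power_0)
  qed
qed

theorem theorem2p8:
  fixes n :: nat
  assumes "n \<ge> 2"
  shows "uniform_hypergraph 3 (comaximal_hypergraph (dihedral_group n)) \<longleftrightarrow>
    (\<exists>\<alpha>::nat. \<alpha> > 0 \<and> n = 2 ^ \<alpha>)"
proof -
  interpret dihedral "dihedral_group n" n "dih_a n" "dih_b n"
    using assms by (simp add: dihedral_dihedral_group)
  have iff: "uniform_hypergraph 3 (comaximal_hypergraph (dihedral_group n)) \<longleftrightarrow>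
      (\<forall>E\<in>comaximal_hyperedges (dihedral_group n). card E = 3)"
    by (simp add: uniform_hypergraph_def comaximal_hypergraph_def)
  show ?thesis
  proof
    assume "uniform_hypergraph 3 (comaximal_hypergraph (dihedral_group n))"
    then have three: "card E = 3" if "E \<in> comaximal_hyperedges (dihedral_group n)" for E
      using iff that by blast
    have "even n" using hyperedge_odd assms three by fastforce
    then have "\<nexists>p. p dvd n \<and> odd p \<and> p \<noteq> 1"
      using hyperedge_even assms three by fastforce
    then obtain \<alpha> where "n = 2 ^ \<alpha>"
      using power_two_or_odd_divisor[of n] assms by auto
    moreover from this have "\<alpha> > 0" using assms by (cases \<alpha>) auto
    ultimately show "\<exists>\<alpha>::nat. \<alpha> > 0 \<and> n = 2 ^ \<alpha>" by blast
  next
    assume "\<exists>\<alpha>::nat. \<alpha> > 0 \<and> n = 2 ^ \<alpha>"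
    then show "uniform_hypergraph 3 (comaximal_hypergraph (dihedral_group n))"
      unfolding iff using hyperedge_card_power_two by blast
  qed
qed

end
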